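(* Let $\boldsymbol{z}\in\mathbb{F}^n$ be an interpolation node, let $\prec$ be a graded order, and let $[\boldsymbol{x}^{\boldsymbol{\alpha}_1},\boldsymbol{x}^{\boldsymbol{\alpha}_2},\dots,\boldsymbol{x}^{\boldsymbol{\alpha}_l}]$ be a sequence of distinct monomials arranged in increasing order with respect to $\prec$. Let $E=(e_{jh})\in\mathbb{F}^{N\times l}$ be an incidence matrix with linearly independent rows, and consider the single-node Birkhoff interpolation conditions $$\Delta=\operatorname{span}\{L_1,\dots,L_N\},\qquad L_j=\delta_{\boldsymbol{z}}\circ\sum_{h=1}^{l}e_{jh}D^{\boldsymbol{\alpha}_h},\quad 1\le j\le N.$$ Let $E_{\mathrm{rref}}$ be the reduced row echelon form of $E$ obtained by Gaussian elimination. Then the monomials $\boldsymbol{x}^{\boldsymbol{\alpha}_h}$ of the sequence for which the $h$-th column is a pivot column of $E_{\mathrm{rref}}$ constitute the minimal monomial basis for $\Delta$ with respect to $\prec$.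
   Context: $\mathbb{F}$ is $\mathbb{R}$ or $\mathbb{C}$ and $\mathbb{F}[\boldsymbol{x}]=\mathbb{F}[x_1,\dots,x_n]$. For $\boldsymbol{\alpha}\in\mathbb{N}^n$, $D^{\boldsymbol{\alpha}}=\partial^{|\boldsymbol{\alpha}|}/\partial x_1^{\alpha_1}\cdots\partial x_n^{\alpha_n}$. $\delta_{\boldsymbol{z}}$ is evaluation at $\boldsymbol{z}$, so $L_j(f)=\sum_h e_{jh}(D^{\boldsymbol{\alpha}_h}f)(\boldsymbol{z})$ for $f\in\mathbb{F}[\boldsymbol{x}]$. A graded order is a monomial order that compares total degree first. For linearly independent functionals $L_1,\dots,L_N$ on $\mathbb{F}[\boldsymbol{x}]$ and $\Delta=\operatorname{span}\{L_1,\dots,L_N\}$, a finite set $T$ of monomials with $|T|=N$ is a proper interpolation basis for $\Delta$ if for all $c_1,\dots,c_N\in\mathbb{F}$ there is a unique $p\in\operatorname{span}T$ with $L_i(p)=c_i$ for all $i$. $T$ is a minimal monomial basis for $\Delta$ with respect to $\prec$ if (1) $T$ is a proper interpolation basis for $\Delta$; (2) replacing any monomial in $T$ by a monomial that is lower in the order $\prec$ can never yield another proper interpolation basis for $\Delta$. *)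

theory Defs
  imports
    "HOL-Library.Poly_Mapping"
    "HOL-Library.Function_Algebras"
    "Jordan_Normal_Form.Gauss_Jordan_Elimination"
    "Jordan_Normal_Form.VS_Connect"
begin

text \<open>
  The variables are indexed by a finite type \<open>'n\<close>.  A monomial is represented by its exponent
  vector; a polynomial maps exponent vectors to coefficients, with finite support.
  The ground field in the theorem has the class \<open>real_normed_field\<close>: by Gelfand--Mazur its members
  are, as fields, exactly the copies of \<open>\<real>\<close> and \<open>\<complex>\<close>.
\<close>

type_synonym 'n monomial = "'n \<Rightarrow>\<^sub>0 nat"
type_synonym ('n, 'a) mpoly = "'n monomial \<Rightarrow>\<^sub>0 'a"
type_synonym ('n, 'a) functional = "('n, 'a) mpoly \<Rightarrow> 'a"

definition monom_poly :: "'n monomial \<Rightarrow> ('n, 'a::field) mpoly" where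
  "monom_poly m = Poly_Mapping.single m 1"

definition eval_at :: "('n \<Rightarrow> 'a) \<Rightarrow> ('n::finite, 'a::field) functional" where
  "eval_at z p =
     (\<Sum>m\<in>Poly_Mapping.keys p.
        Poly_Mapping.lookup p m * (\<Prod>i\<in>UNIV. z i ^ Poly_Mapping.lookup m i))"

text \<open>
  The subtraction of exponents truncates at \<open>0\<close>, but only in terms whose coefficient vanishes.
\<close>

definition partial_deriv :: "'n \<Rightarrow> ('n, 'a::field) mpoly \<Rightarrow> ('n, 'a) mpoly" where
  "partial_deriv i p =
     (\<Sum>m\<in>Poly_Mapping.keys p.
        Poly_Mapping.single (m - Poly_Mapping.single i 1)
          (of_nat (Poly_Mapping.lookup m i) * Poly_Mapping.lookup p m))"

lemma lookup_partial_deriv: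
  "Poly_Mapping.lookup (partial_deriv i p) m =
     of_nat (Poly_Mapping.lookup m i + 1) *
       Poly_Mapping.lookup p (m + Poly_Mapping.single i 1)"
proof -
  let ?e = "Poly_Mapping.single i (1::nat)"
  have shift: "m' = m + ?e" if "m' - ?e = m" "Poly_Mapping.lookup m' i \<noteq> 0" for m'
  proof (rule poly_mapping_eqI)
    fix k
    show "Poly_Mapping.lookup m' k = Poly_Mapping.lookup (m + ?e) k"
      using that by (auto simp: lookup_minus lookup_add lookup_single when_def)
  qed
  have "Poly_Mapping.lookup (partial_deriv i p) m =
      (\<Sum>m'\<in>Poly_Mapping.keys p.
        if m' = m + ?e then of_nat (Poly_Mapping.lookup m' i) * Poly_Mapping.lookup p m' else 0)"
    unfolding partial_deriv_def lookup_sum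
  proof (rule sum.cong[OF refl])
    fix m'
    show "Poly_Mapping.lookup
        (Poly_Mapping.single (m' - ?e) (of_nat (Poly_Mapping.lookup m' i) * Poly_Mapping.lookup p m')) m
      = (if m' = m + ?e then of_nat (Poly_Mapping.lookup m' i) * Poly_Mapping.lookup p m' else 0)"
    proof (cases "Poly_Mapping.lookup m' i = 0")
      case True
      then have "m' \<noteq> m + ?e" by (auto simp: lookup_add)
      with True show ?thesis by simp
    next
      case False
      then have "m' - ?e = m \<longleftrightarrow> m' = m + ?e"
        using shift[of m'] by (metis add_diff_cancel_right')
      then show ?thesis by (simp only: lookup_single when_def)
    qed
  qed
  also have "\<dots> = of_nat (Poly_Mapping.lookup m i + 1) * Poly_Mapping.lookup p (m + ?e)"
    by (simp add: sum.delta lookup_add in_keys_iff)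
  finally show ?thesis .
qed

lemma partial_deriv_commute:
  "partial_deriv i (partial_deriv j p) = partial_deriv j (partial_deriv i p)"
proof (cases "i = j")
  case False
  show ?thesis
    by (rule poly_mapping_eqI)
      (use False in \<open>simp add: lookup_partial_deriv lookup_add lookup_single when_def ac_simps\<close>)
qed simp

text \<open>
  The order in which the fold runs through the variables is irrelevant, since partial
  derivatives commute.
\<close>

definition mderiv :: "'n monomial \<Rightarrow> ('n::finite, 'a::field) mpoly \<Rightarrow> ('n, 'a) mpoly" where
  "mderiv \<alpha> p = Finite_Set.fold (\<lambda>i. partial_deriv i ^^ Poly_Mapping.lookup \<alpha> i) p UNIV"

lemma comp_fun_commute_mderiv:
  fixes \<alpha> :: "'n monomial"
  shows "comp_fun_commute
    (\<lambda>i. (partial_deriv i :: ('n, 'a::field) mpoly \<Rightarrow> _) ^^ Poly_Mapping.lookup \<alpha> i)"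
proof -
  have *: "f ((g ^^ b) p) = (g ^^ b) (f p)"
    if "\<And>q. f (g q) = g (f q)" for f g :: "('n, 'a) mpoly \<Rightarrow> ('n, 'a) mpoly" and b p
    by (induction b) (simp_all add: that)
  have "(f ^^ a) ((g ^^ b) p) = (g ^^ b) ((f ^^ a) p)"
    if "\<And>q. f (g q) = g (f q)" for f g :: "('n, 'a) mpoly \<Rightarrow> ('n, 'a) mpoly" and a b p
    by (rule *, rule *[symmetric], rule that[symmetric])
  then show ?thesis
    by (intro comp_fun_commute.intro ext) (simp only: comp_apply partial_deriv_commute)
qed

definition mpoly_scale :: "'a::field \<Rightarrow> ('n, 'a) mpoly \<Rightarrow> ('n, 'a) mpoly" where
  "mpoly_scale c p = Poly_Mapping.single 0 c * p"

global_interpretation mpoly: vector_space "mpoly_scale :: 'a::field \<Rightarrow> ('n, 'a) mpoly \<Rightarrow> _"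
  by unfold_locales
    (simp_all add: mpoly_scale_def distrib_left distrib_right single_add mult_single
      flip: mult.assoc)

definition functional_scale :: "'a::field \<Rightarrow> ('n, 'a) functional \<Rightarrow> ('n, 'a) functional" where
  "functional_scale c L = (\<lambda>p. c * L p)"

global_interpretation functional:
  vector_space "functional_scale :: 'a::field \<Rightarrow> ('n, 'a) functional \<Rightarrow> _"
  by unfold_locales (simp_all add: functional_scale_def fun_eq_iff algebra_simps)

definition total_degree :: "'n::finite monomial \<Rightarrow> nat" where
  "total_degree m = (\<Sum>i\<in>UNIV. Poly_Mapping.lookup m i)"

definition monomial_order :: "('n monomial \<Rightarrow> 'n monomial \<Rightarrow> bool) \<Rightarrow> bool" where
  "monomial_order prec \<longleftrightarrow>
     transp prec \<and> totalp prec \<and> wfp prec \<and>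
     (\<forall>a b c. prec a b \<longrightarrow> prec (a + c) (b + c))"

definition graded_order :: "('n::finite monomial \<Rightarrow> 'n monomial \<Rightarrow> bool) \<Rightarrow> bool" where
  "graded_order prec \<longleftrightarrow>
     monomial_order prec \<and> (\<forall>a b. total_degree a < total_degree b \<longrightarrow> prec a b)"

text \<open>
  The condition does not depend on the choice of the basis \<open>L\<close> of \<open>\<Delta>\<close>, so it is
  immaterial that \<open>L\<close> is quantified existentially.
\<close>

definition proper_interpolation_basis ::
    "('n, 'a::field) functional set \<Rightarrow> 'n monomial set \<Rightarrow> bool" where
  "proper_interpolation_basis \<Delta> T \<longleftrightarrow>
     (\<exists>N L. (\<forall>i<N. Vector_Spaces.linear mpoly_scale (*) (L i)) \<and>
        inj_on L {..<N} \<and> functional.independent (L ` {..<N}) \<and>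
        \<Delta> = functional.span (L ` {..<N}) \<and>
        finite T \<and> card T = N \<and>
        (\<forall>c :: nat \<Rightarrow> 'a. \<exists>!p. p \<in> mpoly.span (monom_poly ` T) \<and> (\<forall>i<N. L i p = c i)))"

definition minimal_monomial_basis ::
    "('n monomial \<Rightarrow> 'n monomial \<Rightarrow> bool) \<Rightarrow> ('n, 'a::field) functional set \<Rightarrow>
      'n monomial set \<Rightarrow> bool" where
  "minimal_monomial_basis prec \<Delta> T \<longleftrightarrow>
     proper_interpolation_basis \<Delta> T \<and>
     (\<forall>m\<in>T. \<forall>m'. prec m' m \<longrightarrow> \<not> proper_interpolation_basis \<Delta> (insert m' (T - {m})))"

text \<open>Rows and columns are numbered from \<open>0\<close>; \<open>\<alpha>s ! h\<close> labels column \<open>h\<close> of \<open>E\<close>.\<close>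

definition birkhoff_functional ::
    "('n \<Rightarrow> 'a) \<Rightarrow> 'n monomial list \<Rightarrow> 'a mat \<Rightarrow> nat \<Rightarrow> ('n::finite, 'a::field) functional" where
  "birkhoff_functional z \<alpha>s E j =
     (\<lambda>f. \<Sum>h<length \<alpha>s. E $$ (j, h) * eval_at z (mderiv (\<alpha>s ! h) f))"

definition lin_indep_rows :: "'a::field mat \<Rightarrow> bool" where
  "lin_indep_rows E \<longleftrightarrow>
     distinct (rows E) \<and>
     \<not> LinearCombinations.module.lin_dep class_ring (module_vec TYPE('a) (dim_col E)) (set (rows E))"

definition pivot_columns :: "'a::field mat \<Rightarrow> nat set" where
  "pivot_columns R = snd ` set (pivot_positions R)"

end

theory Submission
  imports Defs "Jordan_Normal_Form.DL_Rank"
begin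

text \<open>
  Let \<open>K\<close> be the space of polynomials annihilated by \<open>\<Delta>\<close>.  If \<open>r\<close> is a row of the reduced
  echelon form with pivot column \<open>h\<close> and \<open>p\<close> has leading monomial \<open>\<alpha>\<^sub>h\<close>, then every derivative
  \<open>D\<^sup>\<alpha> p\<close> with \<open>\<alpha>\<close> above \<open>\<alpha>\<^sub>h\<close> vanishes and \<open>D p\<close> for \<open>\<alpha>\<^sub>h\<close> itself is a nonzero constant; so
  the functional of \<open>r\<close> does not kill \<open>p\<close>, wherever \<open>z\<close> lies.  Hence no nonzero element of \<open>K\<close> has
  its leading monomial in \<open>T\<close>.  As \<open>T\<close> has \<open>N = dim \<Delta>\<close> elements and its span meets \<open>K\<close> only in \<open>0\<close>, it
  is an interpolation basis.  If \<open>S\<close> is any interpolation basis and \<open>m \<notin> S\<close>, then some nonzero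
  \<open>p \<in> K\<close> is supported on \<open>S \<union> {m}\<close>, and its leading monomial lies outside \<open>T\<close>.  For \<open>S = T\<close>
  this monomial must be \<open>m\<close>, so \<open>m\<close> cannot replace a larger element of \<open>T\<close>; for \<open>m \<in> T\<close> it is
  an element of \<open>S\<close> larger than \<open>m\<close> that \<open>m\<close> can replace, so only \<open>T\<close> is minimal.
\<close>

section \<open>Polynomials and the span of a set of monomials\<close>

lemma lookup_mpoly_scale [simp]:
  "Poly_Mapping.lookup (mpoly_scale c p) m = c * Poly_Mapping.lookup p m"
  unfolding mpoly_scale_def mult_map_scale_conv_mult[symmetric]
  by (simp add: Poly_Mapping.map.rep_eq when_def)

lemma keys_mpoly_scale_subset: "Poly_Mapping.keys (mpoly_scale c p) \<subseteq> Poly_Mapping.keys p"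
  by (auto simp: in_keys_iff)

lemma lookup_monom_poly: "Poly_Mapping.lookup (monom_poly m) k = (if k = m then 1 else 0)"
  by (auto simp: monom_poly_def lookup_single when_def)

lemma inj_monom_poly: "inj (monom_poly :: 'n monomial \<Rightarrow> ('n, 'a::field) mpoly)"
proof (rule injI)
  fix m m' :: "'n monomial"
  assume "(monom_poly m :: ('n, 'a) mpoly) = monom_poly m'"
  then have "Poly_Mapping.keys (monom_poly m :: ('n, 'a) mpoly) =
      Poly_Mapping.keys (monom_poly m' :: ('n, 'a) mpoly)"
    by (rule arg_cong)
  then show "m = m'" by (simp add: monom_poly_def)
qed

lemma sum_scale_monom_poly:
  "(\<Sum>m\<in>Poly_Mapping.keys p. mpoly_scale (Poly_Mapping.lookup p m) (monom_poly m)) = p"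
proof (rule poly_mapping_eqI)
  fix k
  let ?s = "\<Sum>m\<in>Poly_Mapping.keys p. mpoly_scale (Poly_Mapping.lookup p m) (monom_poly m)"
  have "Poly_Mapping.lookup ?s k
      = (\<Sum>m\<in>Poly_Mapping.keys p. if k = m then Poly_Mapping.lookup p m else 0)"
    unfolding lookup_sum by (rule sum.cong) (simp_all add: lookup_monom_poly)
  then show "Poly_Mapping.lookup ?s k = Poly_Mapping.lookup p k"
    by (simp add: sum.delta' in_keys_iff)
qed

text \<open>Turns span membership into a condition on the support, the form in which all later
  arguments are stated.\<close>

lemma span_monom_poly:
  "mpoly.span (monom_poly ` T) = {p :: ('n, 'a::field) mpoly. Poly_Mapping.keys p \<subseteq> T}"
proof
  have "mpoly.subspace {p :: ('n, 'a) mpoly. Poly_Mapping.keys p \<subseteq> T}"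
  proof (rule mpoly.subspaceI)
    fix p q :: "('n, 'a) mpoly" and c
    assume p: "p \<in> {p. Poly_Mapping.keys p \<subseteq> T}"
    then show "mpoly_scale c p \<in> {p. Poly_Mapping.keys p \<subseteq> T}"
      using keys_mpoly_scale_subset[of c p] by simp
    assume "q \<in> {p. Poly_Mapping.keys p \<subseteq> T}"
    with p show "p + q \<in> {p. Poly_Mapping.keys p \<subseteq> T}"
      using Poly_Mapping.keys_add[of p q] by blast
  qed simp
  then show "mpoly.span (monom_poly ` T) \<subseteq> {p :: ('n, 'a) mpoly. Poly_Mapping.keys p \<subseteq> T}"
    by (intro mpoly.span_minimal) (auto simp: monom_poly_def)
  show "{p :: ('n, 'a) mpoly. Poly_Mapping.keys p \<subseteq> T} \<subseteq> mpoly.span (monom_poly ` T)"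
  proof safe
    fix p :: "('n, 'a) mpoly"
    assume "Poly_Mapping.keys p \<subseteq> T"
    then have "(\<Sum>m\<in>Poly_Mapping.keys p. mpoly_scale (Poly_Mapping.lookup p m) (monom_poly m))
        \<in> mpoly.span (monom_poly ` T)"
      by (intro mpoly.span_sum mpoly.span_scale mpoly.span_base) blast
    then show "p \<in> mpoly.span (monom_poly ` T)"
      by (simp only: sum_scale_monom_poly)
  qed
qed

lemma independent_monom_poly:
  "mpoly.independent ((monom_poly :: _ \<Rightarrow> ('n, 'a::field) mpoly) ` T)"
  unfolding mpoly.dependent_def
proof safe
  fix m assume "(monom_poly m :: ('n, 'a) mpoly) \<in> mpoly.span (monom_poly ` T - {monom_poly m})"
  also have "monom_poly ` T - {monom_poly m :: ('n, 'a) mpoly} = monom_poly ` (T - {m})"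
    by (simp add: image_set_diff[OF inj_monom_poly])
  finally have "Poly_Mapping.keys (monom_poly m :: ('n, 'a) mpoly) \<subseteq> T - {m}"
    unfolding span_monom_poly by simp
  then show False by (simp add: monom_poly_def)
qed

section \<open>Dimension counts in a coordinate space\<close>

text \<open>Sequences that vanish from \<open>N\<close> on serve as the \<open>N\<close>-dimensional
  coordinate space, so that one type covers every \<open>N\<close>.\<close>

definition seq_scale :: "'a::field \<Rightarrow> (nat \<Rightarrow> 'a) \<Rightarrow> nat \<Rightarrow> 'a" where
  "seq_scale c f = (\<lambda>i. c * f i)"

global_interpretation seq: vector_space "seq_scale :: 'a::field \<Rightarrow> (nat \<Rightarrow> 'a) \<Rightarrow> _"
  by unfold_locales
    (simp_all only: seq_scale_def fun_eq_iff plus_fun_apply distrib_left distrib_right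
      mult.assoc mult_1_left simp_thms)

lemma seq_span_unit:
  fixes f :: "nat \<Rightarrow> 'a::field"
  assumes "\<And>i. N \<le> i \<Longrightarrow> f i = 0"
  shows "f \<in> seq.span ((\<lambda>k i. if i = k then 1 else 0) ` {..<N})"
proof -
  define g where "g = (\<Sum>k<N. seq_scale (f k) (\<lambda>i. if i = k then 1 else 0))"
  have sum_apply: "(\<Sum>k<n. h k) i = (\<Sum>k<n. h k i)" for h :: "nat \<Rightarrow> nat \<Rightarrow> 'a" and n i
    by (induction n) simp_all
  have "g i = f i" for i
  proof -
    have "g i = (\<Sum>k<N. if k = i then f k else 0)"
      unfolding g_def sum_apply by (rule sum.cong) (auto simp: seq_scale_def)
    then show "g i = f i" using assms[of i] by (simp add: sum.delta)
  qed
  then have "g = f" by (rule ext)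
  moreover have "g \<in> seq.span ((\<lambda>k i. if i = k then 1 else 0) ` {..<N})"
    unfolding g_def by (intro seq.span_sum seq.span_scale seq.span_base) auto
  ultimately show ?thesis by simp
qed

lemma seq_independent_card_le:
  fixes S :: "(nat \<Rightarrow> 'a::field) set"
  assumes "seq.independent S" and zero: "\<And>f i. f \<in> S \<Longrightarrow> N \<le> i \<Longrightarrow> f i = 0"
  shows "finite S \<and> card S \<le> N"
proof -
  let ?U = "(\<lambda>k i. if i = k then 1 else 0 :: 'a) ` {..<N}"
  have "S \<subseteq> seq.span ?U"
    using seq_span_unit zero by blast
  then have "finite S \<and> card S \<le> card ?U"
    using assms(1) by (intro seq.independent_span_bound) simp_all
  moreover have "card ?U \<le> N"
    using card_image_le[of "{..<N}"] by simp
  ultimately show ?thesis by linarith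
qed

text \<open>
  The second assumption says that \<open>T\<close> is linearly independent modulo the common kernel of the
  functionals.
\<close>

context
  fixes L :: "nat \<Rightarrow> ('n, 'a::field) functional" and N :: nat and T :: "'n monomial set"
  assumes linear: "\<And>i. i < N \<Longrightarrow> Vector_Spaces.linear mpoly_scale (*) (L i)"
    and separated: "\<And>p. Poly_Mapping.keys p \<subseteq> T \<Longrightarrow> (\<And>i. i < N \<Longrightarrow> L i p = 0) \<Longrightarrow> p = 0"
begin

text \<open>The default 0 from index \<open>N\<close> on places every image in the space to which
  \<open>seq_independent_card_le\<close> applies.\<close>

private definition evals :: "('n, 'a) mpoly \<Rightarrow> nat \<Rightarrow> 'a" where
  "evals p i = (if i < N then L i p else 0)"

private lemma linear_evals: "Vector_Spaces.linear mpoly_scale seq_scale evals"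
  unfolding Vector_Spaces.linear_iff
proof (intro conjI allI mpoly.vector_space_axioms seq.vector_space_axioms ext)
  fix p q c i
  show "evals (p + q) i = (evals p + evals q) i"
    using linear[of i] by (cases "i < N") (simp_all add: evals_def Vector_Spaces.linear_iff)
  show "evals (mpoly_scale c p) i = seq_scale c (evals p) i"
    using linear[of i] by (cases "i < N") (simp_all add: evals_def seq_scale_def Vector_Spaces.linear_iff)
qed

text \<open>By \<open>separated\<close>, the kernel of \<open>evals\<close> meets the span of
  \<open>T\<close> only in 0, so \<open>evals\<close> is injective there and preserves the
  independence of the monomials.\<close>

private lemma evals_image:
  "seq.independent (evals ` monom_poly ` T)" "inj_on evals (monom_poly ` T)"
proof -
  interpret Vector_Spaces.linear mpoly_scale seq_scale evals by (rule linear_evals)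
  have inj: "inj_on evals (mpoly.span (monom_poly ` T))"
    unfolding inj_on_iff_eq_0[OF mpoly.subspace_span]
  proof (intro ballI impI)
    fix p assume "p \<in> mpoly.span (monom_poly ` T)" and zero: "evals p = 0"
    then have "Poly_Mapping.keys p \<subseteq> T" unfolding span_monom_poly by simp
    moreover have "L i p = 0" if "i < N" for i
      using fun_cong[OF zero, of i] that by (simp add: evals_def)
    ultimately show "p = 0" by (rule separated)
  qed
  then show "seq.independent (evals ` monom_poly ` T)"
    by (intro independent_injective_image independent_monom_poly)
  show "inj_on evals (monom_poly ` T)"
    using inj mpoly.span_superset by (rule inj_on_subset)
qed

private lemma inj_on_evals_monom_poly: "inj_on (\<lambda>m. evals (monom_poly m)) T"
proof (rule inj_onI)
  fix m m' assume "m \<in> T" "m' \<in> T" "evals (monom_poly m) = evals (monom_poly m')"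
  then have "(monom_poly m :: ('n, 'a) mpoly) = monom_poly m'"
    by (intro inj_onD[OF evals_image(2)] imageI)
  then show "m = m'" by (rule injD[OF inj_monom_poly])
qed

private lemma card_evals_image: "card (evals ` monom_poly ` T) = card T"
  using card_image[OF inj_on_evals_monom_poly] by (simp add: image_image)

text \<open>The monomials of \<open>T\<close> have independent images in an
  \<open>N\<close>-dimensional space. Contrapositively, on any \<open>N + 1\<close> monomials some
  nonzero polynomial is killed by all \<open>N\<close> functionals.\<close>

lemma separated_card_le: "finite T \<and> card T \<le> N"
proof -
  have "finite (evals ` monom_poly ` T) \<and> card (evals ` monom_poly ` T) \<le> N"
    by (rule seq_independent_card_le[OF evals_image(1)]) (auto simp: evals_def)
  then have "finite ((\<lambda>m. evals (monom_poly m)) ` T) \<and> card T \<le> N"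
    unfolding card_evals_image by (simp only: image_image)
  then show ?thesis
    using finite_imageD[OF _ inj_on_evals_monom_poly] by blast
qed

text \<open>\<open>N\<close> independent vectors span an \<open>N\<close>-dimensional space: a value
  vector outside their span would give \<open>N + 1\<close> independent ones.\<close>

lemma separated_surj:
  assumes "card T = N"
  shows "\<exists>p. Poly_Mapping.keys p \<subseteq> T \<and> (\<forall>i<N. L i p = c i)"
proof -
  interpret Vector_Spaces.linear mpoly_scale seq_scale evals by (rule linear_evals)
  define d where "d i = (if i < N then c i else 0)" for i
  let ?B = "evals ` monom_poly ` T"
  have "d \<in> seq.span ?B"
  proof (rule ccontr)
    assume not: "d \<notin> seq.span ?B"
    have zero: "f i = 0" if "f \<in> insert d ?B" "N \<le> i" for f i
      using that by (elim insertE imageE) (simp_all only: d_def evals_def not_less[symmetric] if_False)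
    have indep: "seq.independent (insert d ?B)"
      by (rule seq.independent_insertI[OF not evals_image(1)])
    have *: "finite (insert d ?B) \<and> card (insert d ?B) \<le> N"
      using indep zero by (rule seq_independent_card_le)
    have "d \<notin> ?B" using not by (rule contrapos_nn) (rule seq.span_base)
    moreover have "finite ?B" using * by (simp only: finite_insert)
    ultimately have "card (insert d ?B) = Suc (card ?B)"
      by (intro card_insert_disjoint)
    with conjunct2[OF *] card_evals_image assms show False by linarith
  qed
  then have "d \<in> evals ` {p. Poly_Mapping.keys p \<subseteq> T}"
    unfolding span_image span_monom_poly .
  then obtain p where p: "Poly_Mapping.keys p \<subseteq> T" "d = evals p"
    by blast
  have "L i p = c i" if "i < N" for i
    using fun_cong[OF p(2), of i] that by (simp add: evals_def d_def)
  with p(1) show ?thesis by blast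
qed

end

section \<open>Criteria for interpolation bases\<close>

lemma kernel_span:
  assumes "\<And>L. L \<in> B \<Longrightarrow> L p = 0" and "L \<in> functional.span B"
  shows "L p = 0"
proof -
  have "functional.subspace {L. L p = 0}"
    by (auto simp: functional.subspace_def functional_scale_def)
  then have "functional.span B \<subseteq> {L. L p = 0}"
    using assms(1) by (intro functional.span_minimal) auto
  then show ?thesis using assms(2) by auto
qed

text \<open>The existential choice of \<open>L\<close> disappears here: the conclusions mention only
  \<Delta>. The last one is uniqueness for the data \<open>c = 0\<close>, where the zero polynomial
  is already a solution.\<close>

lemma proper_interpolation_basisD:
  assumes "proper_interpolation_basis \<Delta> T"
  shows "finite T" "card T = functional.dim \<Delta>"
    and "Poly_Mapping.keys p \<subseteq> T \<Longrightarrow> (\<And>L. L \<in> \<Delta> \<Longrightarrow> L p = 0) \<Longrightarrow> p = 0"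
proof -
  obtain N L where lin: "\<forall>i<N. Vector_Spaces.linear mpoly_scale (*) (L i)"
    and inj: "inj_on L {..<N}" and indep: "functional.independent (L ` {..<N})"
    and \<Delta>: "\<Delta> = functional.span (L ` {..<N})" and fin: "finite T" and card: "card T = N"
    and uniq: "\<forall>c. \<exists>!p. p \<in> mpoly.span (monom_poly ` T) \<and> (\<forall>i<N. L i p = c i)"
    using assms unfolding proper_interpolation_basis_def by blast
  show "finite T" by (rule fin)
  show "card T = functional.dim \<Delta>"
    using functional.dim_span_eq_card_independent[OF indep] card_image[OF inj] card
    by (simp add: \<Delta>)
  assume p: "Poly_Mapping.keys p \<subseteq> T" "\<And>L. L \<in> \<Delta> \<Longrightarrow> L p = 0"
  have "L i q = 0" if "i < N" "q = 0" for i q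
  proof -
    interpret Vector_Spaces.linear mpoly_scale "(*)" "L i" using lin that(1) by blast
    show ?thesis using that(2) by (simp add: zero)
  qed
  moreover have "L i p = 0" if "i < N" for i
    using that by (intro p(2)) (auto simp: \<Delta> intro: functional.span_base)
  ultimately show "p = 0"
    using uniq[rule_format, of "\<lambda>_. 0"] p(1) mpoly.span_zero
    by (metis (mono_tags, lifting) mem_Collect_eq span_monom_poly)
qed

text \<open>Surjectivity supplies dual polynomials, on which exactly one functional is 1 and the
  others are 0. Evaluating at them refutes any coincidence or linear relation.\<close>

lemma separated_independent:
  assumes lin: "\<And>i. i < N \<Longrightarrow> Vector_Spaces.linear mpoly_scale (*) (L i)"
    and sep: "\<And>p. Poly_Mapping.keys p \<subseteq> T \<Longrightarrow> (\<And>i. i < N \<Longrightarrow> L i p = 0) \<Longrightarrow> p = 0"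
    and card: "card T = N"
  shows "inj_on L {..<N}" "functional.independent (L ` {..<N})"
proof -
  have dual: "\<exists>p. \<forall>i<N. L i p = (if i = k then 1 else 0)" for k
  proof -
    have "\<exists>p. Poly_Mapping.keys p \<subseteq> T \<and> (\<forall>i<N. L i p = (if i = k then 1 else 0))"
      by (rule separated_surj[of N L T]) (fact lin sep card)+
    then show ?thesis by blast
  qed
  show "inj_on L {..<N}"
  proof (rule inj_onI)
    fix i j assume ij: "i \<in> {..<N}" "j \<in> {..<N}" "L i = L j"
    obtain p where "\<forall>k<N. L k p = (if k = i then 1 else 0)" using dual by blast
    with ij show "i = j" by (metis lessThan_iff zero_neq_one)
  qed
  show "functional.independent (L ` {..<N})"
    unfolding functional.dependent_def
  proof safe
    fix k assume k: "k < N" and mem: "L k \<in> functional.span (L ` {..<N} - {L k})"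
    obtain p where p: "\<forall>i<N. L i p = (if i = k then 1 else 0)" using dual by blast
    have "L k p = 0"
      by (rule kernel_span[OF _ mem]) (use p in auto)
    with p k show False by auto
  qed
qed

text \<open>Existence is \<open>separated_surj\<close>; uniqueness holds because the difference of
  two solutions is killed by every functional. Independence of the functionals comes out of the
  separation as well.\<close>

lemma proper_interpolation_basisI:
  fixes L :: "nat \<Rightarrow> ('n, 'a::field) functional"
  assumes lin: "\<And>i. i < N \<Longrightarrow> Vector_Spaces.linear mpoly_scale (*) (L i)"
    and sep: "\<And>p. Poly_Mapping.keys p \<subseteq> T \<Longrightarrow> (\<And>i. i < N \<Longrightarrow> L i p = 0) \<Longrightarrow> p = 0"
    and card: "card T = N"
  shows "proper_interpolation_basis (functional.span (L ` {..<N})) T"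
  unfolding proper_interpolation_basis_def
proof (intro exI[of _ N] exI[of _ L] conjI allI impI refl)
  show "finite T"
    by (rule conjunct1, rule separated_card_le[of N L T]) (fact lin sep)+
  fix c :: "nat \<Rightarrow> 'a"
  have "\<exists>p. Poly_Mapping.keys p \<subseteq> T \<and> (\<forall>i<N. L i p = c i)"
    by (rule separated_surj[of N L T]) (fact lin sep card)+
  then obtain p where p: "Poly_Mapping.keys p \<subseteq> T" "\<And>i. i < N \<Longrightarrow> L i p = c i"
    by blast
  show "\<exists>!p. p \<in> mpoly.span (monom_poly ` T) \<and> (\<forall>i<N. L i p = c i)"
  proof (rule ex1I[of _ p])
    show "p \<in> mpoly.span (monom_poly ` T) \<and> (\<forall>i<N. L i p = c i)"
      using p by (simp add: span_monom_poly)
    fix q assume q: "q \<in> mpoly.span (monom_poly ` T) \<and> (\<forall>i<N. L i q = c i)"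
    have "q - p = 0"
    proof (rule sep)
      have "q - p \<in> mpoly.span (monom_poly ` T)"
        using q p by (intro mpoly.span_diff) (auto simp: span_monom_poly)
      then show "Poly_Mapping.keys (q - p) \<subseteq> T" by (simp add: span_monom_poly)
      show "L i (q - p) = 0" if "i < N" for i
      proof -
        interpret Vector_Spaces.linear mpoly_scale "(*)" "L i" by (rule lin[OF that])
        show ?thesis using that p q by (simp add: diff)
      qed
    qed
    then show "q = p" by simp
  qed
next
  show "inj_on L {..<N}"
    by (rule separated_independent[of N L T]) (fact lin sep card)+
  show "functional.independent (L ` {..<N})"
    by (rule separated_independent[of N L T]) (fact lin sep card)+
qed (fact lin card)+

section \<open>Derivatives, evaluation and Birkhoff functionals\<close>

text \<open>Indexing by the exponent after differentiation makes the factor a rising factorial,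
  whose recursion matches one further derivative.\<close>

lemma lookup_funpow_partial_deriv:
  "Poly_Mapping.lookup ((partial_deriv i ^^ k) p) m =
    pochhammer (of_nat (Poly_Mapping.lookup m i) + 1) k * Poly_Mapping.lookup p (m + Poly_Mapping.single i k)"
proof (induction k arbitrary: m)
  case (Suc k)
  have "Poly_Mapping.single i (1::nat) + Poly_Mapping.single i k = Poly_Mapping.single i (Suc k)"
    by (simp flip: single_add)
  then show ?case
    by (simp add: lookup_partial_deriv Suc.IH pochhammer_rec lookup_add add.assoc mult.assoc)
       (simp add: algebra_simps)
qed simp

lemma sum_single_lookup:
  "(\<Sum>i\<in>UNIV. Poly_Mapping.single i (Poly_Mapping.lookup \<alpha> i)) = (\<alpha> :: 'n::finite monomial)"
  by (rule poly_mapping_eqI) (simp add: lookup_sum lookup_single when_def sum.delta)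

lemma lookup_mderiv:
  fixes p :: "('n::finite, 'a::field) mpoly"
  shows "Poly_Mapping.lookup (mderiv \<alpha> p) m =
    (\<Prod>i\<in>UNIV. pochhammer (of_nat (Poly_Mapping.lookup m i) + 1) (Poly_Mapping.lookup \<alpha> i)) *
      Poly_Mapping.lookup p (m + \<alpha>)"
proof -
  interpret comp_fun_commute "\<lambda>i. (partial_deriv i :: ('n, 'a) mpoly \<Rightarrow> _) ^^ Poly_Mapping.lookup \<alpha> i"
    by (rule comp_fun_commute_mderiv)
  have "Poly_Mapping.lookup (Finite_Set.fold (\<lambda>i. partial_deriv i ^^ Poly_Mapping.lookup \<alpha> i) p S) m =
    (\<Prod>i\<in>S. pochhammer (of_nat (Poly_Mapping.lookup m i) + 1) (Poly_Mapping.lookup \<alpha> i)) *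
      Poly_Mapping.lookup p (m + (\<Sum>i\<in>S. Poly_Mapping.single i (Poly_Mapping.lookup \<alpha> i)))"
    if "finite S" for S
    using that
  proof (induction S arbitrary: m)
    case (insert x F)
    let ?s = "Poly_Mapping.single x (Poly_Mapping.lookup \<alpha> x)"
    \<comment> \<open>Differentiating in \<open>x\<close> shifts only the exponent of
      \<open>x\<close>, which is not in \<open>F\<close>, so the factors for \<open>F\<close> are
      unchanged.\<close>
    have "(\<Prod>i\<in>F. pochhammer (of_nat (Poly_Mapping.lookup (m + ?s) i) + 1) (Poly_Mapping.lookup \<alpha> i)) =
        (\<Prod>i\<in>F. pochhammer (of_nat (Poly_Mapping.lookup m i) + 1 :: 'a) (Poly_Mapping.lookup \<alpha> i))"
      using insert.hyps by (intro prod.cong) (auto simp: lookup_add lookup_single when_def)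
    then show ?case
      using insert.hyps by (simp add: lookup_funpow_partial_deriv insert.IH add.assoc mult.assoc)
  qed simp
  from this[of UNIV] show ?thesis
    by (simp add: mderiv_def sum_single_lookup)
qed

lemma linear_mderiv: "Vector_Spaces.linear mpoly_scale mpoly_scale (mderiv \<alpha>)"
  unfolding Vector_Spaces.linear_iff
  by (auto intro!: poly_mapping_eqI mpoly.vector_space_axioms
      simp: lookup_mderiv lookup_add distrib_left mult.left_commute)

lemma eval_at_eq_sum:
  assumes "finite A" "Poly_Mapping.keys p \<subseteq> A"
  shows "eval_at z p =
    (\<Sum>m\<in>A. Poly_Mapping.lookup p m * (\<Prod>i\<in>UNIV. z i ^ Poly_Mapping.lookup m i))"
  unfolding eval_at_def using assms
  by (intro sum.mono_neutral_left) (auto simp: in_keys_iff)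

lemma vector_space_times: "vector_space ((*) :: 'a::field \<Rightarrow> _)"
  by unfold_locales (simp_all add: algebra_simps)

lemma linear_eval_at:
  "Vector_Spaces.linear mpoly_scale (*) (eval_at z :: ('n::finite, 'a::field) functional)"
  unfolding Vector_Spaces.linear_iff
proof (intro conjI allI mpoly.vector_space_axioms vector_space_times)
  fix p q :: "('n, 'a) mpoly" and c
  let ?A = "Poly_Mapping.keys p \<union> Poly_Mapping.keys q"
  show "eval_at z (p + q) = eval_at z p + eval_at z q"
    using Poly_Mapping.keys_add[of p q]
    by (simp add: eval_at_eq_sum[of ?A] lookup_add distrib_right sum.distrib)
  show "eval_at z (mpoly_scale c p) = c * eval_at z p"
    using keys_mpoly_scale_subset[of c p]
    by (simp add: eval_at_eq_sum[of "Poly_Mapping.keys p"] sum_distrib_left mult.assoc)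
qed

lemma linear_birkhoff_functional:
  "Vector_Spaces.linear mpoly_scale (*) (birkhoff_functional z \<alpha>s E j)"
proof -
  have "Vector_Spaces.linear mpoly_scale (*) (\<lambda>p. eval_at z (mderiv \<alpha> p))" for \<alpha>
    using Vector_Spaces.linear_compose[OF linear_mderiv linear_eval_at] by (simp add: comp_def)
  then show ?thesis
    unfolding Vector_Spaces.linear_iff birkhoff_functional_def
    by (simp add: sum.distrib distrib_left sum_distrib_left mult.left_commute)
qed

text \<open>Row operations on \<open>E\<close> combine the functionals in the same way, so a
  polynomial killed by the conditions of \<open>E\<close> is killed by those of the echelon
  form.\<close>

lemma birkhoff_functional_mult:
  assumes "P \<in> carrier_mat N N" "E \<in> carrier_mat N (length \<alpha>s)" "i < N"
  shows "birkhoff_functional z \<alpha>s (P * E) i f = (\<Sum>j<N. P $$ (i, j) * birkhoff_functional z \<alpha>s E j f)"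
proof -
  have "birkhoff_functional z \<alpha>s (P * E) i f =
    (\<Sum>h<length \<alpha>s. \<Sum>j<N. P $$ (i, j) * (E $$ (j, h) * eval_at z (mderiv (\<alpha>s ! h) f)))"
    using assms
    by (simp add: birkhoff_functional_def scalar_prod_def sum_distrib_right mult.assoc lessThan_atLeast0)
  also have "\<dots> = (\<Sum>j<N. \<Sum>h<length \<alpha>s. P $$ (i, j) * (E $$ (j, h) * eval_at z (mderiv (\<alpha>s ! h) f)))"
    by (rule sum.swap)
  finally show ?thesis
    by (simp add: birkhoff_functional_def sum_distrib_left)
qed

text \<open>No proper multiple of the monomial \<alpha> occurs in \<open>p\<close>, so the
  derivative is constant and the node \<open>z\<close> drops out.\<close>

lemma eval_at_mderiv_leading:
  assumes "\<And>m. m \<noteq> 0 \<Longrightarrow> Poly_Mapping.lookup p (m + \<alpha>) = 0"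
  shows "eval_at z (mderiv \<alpha> p) = (\<Prod>i\<in>UNIV. fact (Poly_Mapping.lookup \<alpha> i)) * Poly_Mapping.lookup p \<alpha>"
proof -
  have "Poly_Mapping.keys (mderiv \<alpha> p) \<subseteq> {0}"
  proof
    fix m assume "m \<in> Poly_Mapping.keys (mderiv \<alpha> p)"
    then have "Poly_Mapping.lookup p (m + \<alpha>) \<noteq> 0" by (simp add: in_keys_iff lookup_mderiv)
    then show "m \<in> {0}" using assms by blast
  qed
  then have "eval_at z (mderiv \<alpha> p) = Poly_Mapping.lookup (mderiv \<alpha> p) 0"
    by (subst eval_at_eq_sum[of "{0}"]) simp_all
  then show ?thesis by (simp add: lookup_mderiv pochhammer_fact)
qed

section \<open>Leading monomials under a graded order\<close>

lemma graded_orderD: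
  assumes "graded_order prec"
  shows "transp prec" "totalp prec" "asymp prec" "m \<noteq> 0 \<Longrightarrow> prec \<alpha> (m + \<alpha>)"
proof -
  have *: "transp prec" "totalp prec" "wfp prec" "total_degree a < total_degree b \<Longrightarrow> prec a b" for a b
    using assms by (auto simp: graded_order_def monomial_order_def)
  show "transp prec" "totalp prec" by fact+
  show "asymp prec" using *(3) by (rule wfp_imp_asymp)
  assume "m \<noteq> 0"
  then obtain i where "Poly_Mapping.lookup m i \<noteq> 0"
    by (metis lookup_zero poly_mapping_eqI)
  then have "0 < total_degree m"
    by (auto simp: total_degree_def sum_eq_0_iff intro: gr0I)
  then show "prec \<alpha> (m + \<alpha>)"
    by (intro *(4)) (simp add: total_degree_def lookup_add sum.distrib)
qed

text \<open>Columns left of the pivot \<open>h\<close> have zero entries, and columns to its right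
  carry vanishing derivatives; only the term for \<open>h\<close> remains.\<close>

lemma birkhoff_functional_leading_nonzero:
  fixes p :: "('n::finite, 'a::field_char_0) mpoly"
  assumes prec: "graded_order prec" and sorted: "sorted_wrt prec \<alpha>s"
    and h: "h < length \<alpha>s" "R $$ (i, h) \<noteq> 0" "\<And>k. k < h \<Longrightarrow> R $$ (i, k) = 0"
    and p: "\<alpha>s ! h \<in> Poly_Mapping.keys p"
      "\<And>m. m \<in> Poly_Mapping.keys p \<Longrightarrow> m \<noteq> \<alpha>s ! h \<Longrightarrow> prec m (\<alpha>s ! h)"
  shows "birkhoff_functional z \<alpha>s R i p \<noteq> 0"
proof -
  note trans = transpD[OF graded_orderD(1)[OF prec]]
  note asym = asympD[OF graded_orderD(3)[OF prec]]
  note grow = graded_orderD(4)[OF prec]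
  have zero: "Poly_Mapping.lookup p m = 0" if "prec (\<alpha>s ! h) m" for m
  proof (rule ccontr)
    assume "Poly_Mapping.lookup p m \<noteq> 0"
    then have "m = \<alpha>s ! h \<or> prec m (\<alpha>s ! h)" using p(2) by (auto simp: in_keys_iff)
    then show False using that asym by blast
  qed
  have later: "eval_at z (mderiv (\<alpha>s ! k) p) = 0" if "h < k" "k < length \<alpha>s" for k
  proof -
    have k: "prec (\<alpha>s ! h) (\<alpha>s ! k)" using sorted that by (simp add: sorted_wrt_iff_nth_less)
    \<comment> \<open>Multiples of a monomial above the leading one are still above it, so none of
      them occurs in \<open>p\<close>.\<close>
    then have "Poly_Mapping.lookup p (m + \<alpha>s ! k) = 0" if "m \<noteq> 0" for m
      by (intro zero) (rule trans[OF k grow[OF that]])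
    then show ?thesis using zero[OF k] by (simp add: eval_at_mderiv_leading)
  qed
  have "birkhoff_functional z \<alpha>s R i p = (\<Sum>k\<in>{h}. R $$ (i, k) * eval_at z (mderiv (\<alpha>s ! k) p))"
    unfolding birkhoff_functional_def
  proof (rule sum.mono_neutral_right)
    show "\<forall>k\<in>{..<length \<alpha>s} - {h}. R $$ (i, k) * eval_at z (mderiv (\<alpha>s ! k) p) = 0"
      using later h(3) by (auto simp: nat_neq_iff)
  qed (use h in auto)
  also have "\<dots> = R $$ (i, h) * ((\<Prod>i\<in>UNIV. fact (Poly_Mapping.lookup (\<alpha>s ! h) i)) * Poly_Mapping.lookup p (\<alpha>s ! h))"
    using zero grow by (simp add: eval_at_mderiv_leading)
  \<comment> \<open>Characteristic 0 keeps the factorials nonzero.\<close>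
  also have "\<dots> \<noteq> 0" using h(2) p(1) by (simp add: in_keys_iff)
  finally show ?thesis .
qed

section \<open>Pivots of the reduced echelon form\<close>

text \<open>Row \<open>i\<close> of \<open>P * E\<close> combines the rows of \<open>E\<close> with
  the entries of row \<open>i\<close> of \<open>P\<close>, which are not all 0 since
  \<open>P\<close> has a right inverse. The transpose appears because \<open>lin_depI\<close> speaks
  of columns.\<close>

lemma lin_indep_rows_left_mult_nonzero:
  fixes E :: "'a::field mat"
  assumes E: "E \<in> carrier_mat N l" and indep: "lin_indep_rows E"
    and P: "P \<in> carrier_mat N N" and Q: "Q \<in> carrier_mat N N" and inv: "P * Q = 1\<^sub>m N"
    and i: "i < N"
  shows "row (P * E) i \<noteq> 0\<^sub>v l"
proof
  assume zero: "row (P * E) i = 0\<^sub>v l"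
  have "row P i \<noteq> 0\<^sub>v N"
  proof
    assume "row P i = 0\<^sub>v N"
    moreover have "row P i \<bullet> col Q i = 1"
      using arg_cong[OF inv, of "\<lambda>A. A $$ (i, i)"] P Q i by simp
    moreover have "col Q i \<in> carrier_vec N" using Q by auto
    ultimately show False by simp
  qed
  moreover have "transpose_mat E *\<^sub>v row P i = 0\<^sub>v l"
  proof (rule eq_vecI)
    fix h assume "h < dim_vec (0\<^sub>v l :: 'a vec)"
    then have h: "h < l" by simp
    have "(transpose_mat E *\<^sub>v row P i) $ h = col E h \<bullet> row P i"
      using E h by simp
    also have "\<dots> = row P i \<bullet> col E h"
      using P E i h by (intro comm_scalar_prod[of _ N]) auto
    also have "\<dots> = row (P * E) i $ h" using P E i h by simp
    finally show "(transpose_mat E *\<^sub>v row P i) $ h = 0\<^sub>v l $ h" using zero by simp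
  qed (use E in auto)
  ultimately have "LinearCombinations.module.lin_dep class_ring (module_vec TYPE('a) l)
      (set (cols (transpose_mat E)))"
    using E P i indep by (intro vec_space.lin_depI[where nc = N and v = "row P i"])
      (auto simp: lin_indep_rows_def)
  then show False using indep E by (simp add: lin_indep_rows_def)
qed

text \<open>No row of the echelon form is zero, so each of the \<open>N\<close> rows has a pivot.
  The pivots lie in distinct columns because a pivot column is zero outside its own row.\<close>

lemma gauss_jordan_single_pivots:
  fixes E :: "'a::field mat"
  assumes E: "E \<in> carrier_mat N l" and indep: "lin_indep_rows E"
  defines "R \<equiv> gauss_jordan_single E"
  obtains f P where "P \<in> carrier_mat N N" "R = P * E"
    "pivot_columns R = f ` {..<N}" "inj_on f {..<N}"
    "\<And>i. i < N \<Longrightarrow> f i < l \<and> R $$ (i, f i) = 1 \<and> (\<forall>j<f i. R $$ (i, j) = 0)"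
proof -
  note gj = gauss_jordan_single[OF E refl, folded R_def]
  obtain P Q where PQ: "R = P * E" "P \<in> carrier_mat N N" "Q \<in> carrier_mat N N" "P * Q = 1\<^sub>m N"
    using gj(4) by blast
  obtain f where f: "pivot_fun R f l"
    using gj(2,3) by (auto simp: row_echelon_form_def)
  have dim: "dim_row R = N" using gj(2) by simp
  note piv = pivot_funD[OF dim f]
  have lt: "f i < l" if "i < N" for i
  proof -
    have "row R i \<noteq> 0\<^sub>v l"
      unfolding PQ(1) by (rule lin_indep_rows_left_mult_nonzero[OF E indep PQ(2-4) that])
    \<comment> \<open>A pivot function marks a zero row by the value \<open>l\<close>, one past the
      last column.\<close>
    then have "f i \<noteq> l" using pivot_fun_zero_row_iff[OF f gj(2) that] by simp
    then show ?thesis using piv(1)[OF that] by simp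
  qed
  show ?thesis
  proof (rule that[OF PQ(2,1)])
    show "pivot_columns R = f ` {..<N}"
      using pivot_positions(1)[OF gj(2) f] lt by (force simp: pivot_columns_def)
    show "inj_on f {..<N}"
    proof (rule inj_onI)
      fix i j assume ij: "i \<in> {..<N}" "j \<in> {..<N}" "f i = f j"
      show "i = j"
      proof (rule ccontr)
        assume "i \<noteq> j"
        with ij have "R $$ (j, f i) = 0" using piv(5)[of i j] lt by simp
        moreover have "R $$ (j, f j) = 1" using ij lt piv(4) by simp
        ultimately show False using ij(3) by simp
      qed
    qed
  qed (use lt piv in auto)
qed

section \<open>Minimality and uniqueness of the set of pivot monomials\<close>

theorem theorem3p2:
  fixes z :: "'n::finite \<Rightarrow> 'a::real_normed_field"
    and prec :: "'n monomial \<Rightarrow> 'n monomial \<Rightarrow> bool"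
    and \<alpha>s :: "'n monomial list"
    and E :: "'a mat"
    and N l :: nat
    and \<Delta> :: "('n, 'a) functional set"
    and T :: "'n monomial set"
  assumes "graded_order prec"
    and "length \<alpha>s = l" and "distinct \<alpha>s" and "sorted_wrt prec \<alpha>s"
    and "E \<in> carrier_mat N l" and "lin_indep_rows E"
  defines "\<Delta> \<equiv> functional.span (birkhoff_functional z \<alpha>s E ` {..<N})"
    and "T \<equiv> (\<lambda>h. \<alpha>s ! h) ` pivot_columns (gauss_jordan_single E)"
  shows "minimal_monomial_basis prec \<Delta> T \<and>
    (\<forall>T'. minimal_monomial_basis prec \<Delta> T' \<longrightarrow> T' = T)"
proof -
  let ?L = "birkhoff_functional z \<alpha>s E"
  let ?R = "gauss_jordan_single E"
  note lin = linear_birkhoff_functional[of z \<alpha>s E]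
  note total = totalpD[OF graded_orderD(2)[OF assms(1)]]
  note asym = asympD[OF graded_orderD(3)[OF assms(1)]]
  obtain f P where P: "P \<in> carrier_mat N N" "?R = P * E"
    and cols: "pivot_columns ?R = f ` {..<N}" and inj: "inj_on f {..<N}"
    and f: "\<And>i. i < N \<Longrightarrow> f i < l \<and> ?R $$ (i, f i) = 1 \<and> (\<forall>j<f i. ?R $$ (i, j) = 0)"
    using gauss_jordan_single_pivots[OF assms(5,6)] by metis
  have T: "T = (\<lambda>i. \<alpha>s ! f i) ` {..<N}"
    by (simp add: T_def cols image_image)
  have "inj_on (\<lambda>i. \<alpha>s ! f i) {..<N}"
    using f inj assms(2,3) by (auto simp: inj_on_def nth_eq_iff_index_eq)
  then have card_T: "card T = N" by (simp add: T card_image)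
  have fin_T: "finite T" by (simp add: T)

  have leading: "\<exists>x\<in>Poly_Mapping.keys p. x \<notin> T \<and> (\<forall>m\<in>Poly_Mapping.keys p. m \<noteq> x \<longrightarrow> prec m x)"
    if nz: "p \<noteq> 0" and zero: "\<And>i. i < N \<Longrightarrow> ?L i p = 0" for p
  proof -
    have "asymp_on (Poly_Mapping.keys p) prec" "transp_on (Poly_Mapping.keys p) prec"
      using graded_orderD(1,3)[OF assms(1)]
      by (simp_all add: asymp_on_subset[OF _ subset_UNIV] transp_on_subset[OF _ subset_UNIV])
    then obtain x where x: "x \<in> Poly_Mapping.keys p" "\<forall>m\<in>Poly_Mapping.keys p. m \<noteq> x \<longrightarrow> \<not> prec x m"
      using Finite_Set.bex_max_element[of "Poly_Mapping.keys p" prec] nz by auto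
    then have max: "\<And>m. m \<in> Poly_Mapping.keys p \<Longrightarrow> m \<noteq> x \<Longrightarrow> prec m x"
      using total by blast
    have "x \<notin> T"
    proof
      assume "x \<in> T"
      then obtain i where i: "i < N" "x = \<alpha>s ! f i" by (auto simp: T)
      have "birkhoff_functional z \<alpha>s ?R i p \<noteq> 0"
        using f[OF i(1)] x(1) max assms(2) i(2)
        by (intro birkhoff_functional_leading_nonzero[OF assms(1,4), of "f i"]) auto
      moreover have "birkhoff_functional z \<alpha>s ?R i p = 0"
        using birkhoff_functional_mult[OF P(1), of E \<alpha>s i z p] assms(2,5) i(1) zero P(2) by simp
      ultimately show False by simp
    qed
    with x(1) max show ?thesis by blast
  qed

  have proper_T: "proper_interpolation_basis \<Delta> T"
    unfolding \<Delta>_def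
  proof (rule proper_interpolation_basisI[OF lin _ card_T])
    show "p = 0" if "Poly_Mapping.keys p \<subseteq> T" "\<And>i. i < N \<Longrightarrow> ?L i p = 0" for p
      using leading[of p] that by blast
  qed
  have properD: "finite S" "card S = N"
      "Poly_Mapping.keys p \<subseteq> S \<Longrightarrow> (\<And>i. i < N \<Longrightarrow> ?L i p = 0) \<Longrightarrow> p = 0"
    if S: "proper_interpolation_basis \<Delta> S" for S p
  proof -
    show "finite S" by (rule proper_interpolation_basisD(1)[OF S])
    show "card S = N"
      \<comment> \<open>The basis \<open>T\<close>, already known to be proper, fixes the dimension
        of \<Delta> as \<open>N\<close>.\<close>
      using proper_interpolation_basisD(2)[OF S] proper_interpolation_basisD(2)[OF proper_T] card_T
      by simp
    assume p: "Poly_Mapping.keys p \<subseteq> S" "\<And>i. i < N \<Longrightarrow> ?L i p = 0"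
    show "p = 0"
      by (rule proper_interpolation_basisD(3)[OF S p(1)])
        (rule kernel_span[of "?L ` {..<N}"], use p(2) in \<open>auto simp: \<Delta>_def\<close>)
  qed
  have dependent: "\<exists>p. p \<noteq> 0 \<and> Poly_Mapping.keys p \<subseteq> insert m S \<and> (\<forall>i<N. ?L i p = 0)"
    if "finite S" "card S = N" "m \<notin> S" for m S
  proof (rule ccontr)
    assume "\<not> ?thesis"
    then have "card (insert m S) \<le> N"
      by (intro conjunct2[OF separated_card_le[of N ?L]] lin) blast
    with that show False by simp
  qed

  have minimal: "\<not> proper_interpolation_basis \<Delta> (insert m' (T - {m}))"
    if m: "m \<in> T" "prec m' m" for m m'
  proof
    assume S: "proper_interpolation_basis \<Delta> (insert m' (T - {m}))"
    \<comment> \<open>Otherwise the exchange would merely delete \<open>m\<close> and leave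
      \<open>N - 1\<close> monomials.\<close>
    have "m' \<notin> T"
    proof
      assume "m' \<in> T"
      then have "insert m' (T - {m}) = T - {m}" using m(2) asym by blast
      then show False
        using properD(2)[OF S] card_Diff1_less[OF fin_T m(1)] card_T by simp
    qed
    then obtain p where p: "p \<noteq> 0" "Poly_Mapping.keys p \<subseteq> insert m' T" "\<And>i. i < N \<Longrightarrow> ?L i p = 0"
      using dependent[OF fin_T card_T] by blast
    obtain x where x: "x \<in> Poly_Mapping.keys p" "x \<notin> T"
        "\<forall>k\<in>Poly_Mapping.keys p. k \<noteq> x \<longrightarrow> prec k x"
      using leading[OF p(1,3)] by blast
    \<comment> \<open>Every monomial of \<open>p\<close> other than \<open>m'\<close> lies in
      \<open>T\<close>. As \<open>m\<close> is above the leading monomial \<open>m'\<close>, it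
      cannot occur, so \<open>p\<close> lives on the alleged basis.\<close>
    then have "x = m'" using p(2) by blast
    then have "m \<notin> Poly_Mapping.keys p" using x(2,3) m(1) asym[OF m(2)] by metis
    then have "Poly_Mapping.keys p \<subseteq> insert m' (T - {m})" using p(2) by blast
    then show False using properD(3)[OF S _ p(3)] p(1) by blast
  qed

  have unique: "T' = T" if T': "minimal_monomial_basis prec \<Delta> T'" for T'
  proof (rule ccontr)
    assume "T' \<noteq> T"
    have S: "proper_interpolation_basis \<Delta> T'"
      using T' by (simp add: minimal_monomial_basis_def)
    note fin = properD(1)[OF S] and card = properD(2)[OF S] and sep = properD(3)[OF S]
    have "\<not> T \<subseteq> T'"
      using card_subset_eq[OF fin] card card_T \<open>T' \<noteq> T\<close> by metis
    then obtain m where m: "m \<in> T" "m \<notin> T'" by blast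
    obtain p where p: "p \<noteq> 0" "Poly_Mapping.keys p \<subseteq> insert m T'" "\<And>i. i < N \<Longrightarrow> ?L i p = 0"
      using dependent[OF fin card m(2)] by blast
    \<comment> \<open>Without \<open>m\<close>, the polynomial \<open>p\<close> would be supported
      on \<open>T'\<close> and hence be 0.\<close>
    have mp: "m \<in> Poly_Mapping.keys p"
      using sep[OF _ p(3)] p(1,2) by blast
    obtain x where x: "x \<in> Poly_Mapping.keys p" "x \<notin> T"
        "\<forall>k\<in>Poly_Mapping.keys p. k \<noteq> x \<longrightarrow> prec k x"
      using leading[OF p(1,3)] by blast
    have "x \<noteq> m" using x(2) m(1) by auto
    then have xm: "x \<in> T'" "prec m x" using x(1,3) mp p(2) by auto
    have "proper_interpolation_basis \<Delta> (insert m (T' - {x}))"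
      unfolding \<Delta>_def
    proof (rule proper_interpolation_basisI[OF lin])
      show "card (insert m (T' - {x})) = N"
        using fin card m(2) xm(1) card_Suc_Diff1[OF fin xm(1)] by simp
      fix q :: "('n, 'a) mpoly"
      assume q: "Poly_Mapping.keys q \<subseteq> insert m (T' - {x})" "\<And>i. i < N \<Longrightarrow> ?L i q = 0"
      \<comment> \<open>The coefficients are chosen to cancel \<open>m\<close>, so \<open>?r\<close>
        is supported on \<open>T'\<close> and killed, hence 0. Since \<open>x\<close> occurs in
        \<open>p\<close> but not in \<open>q\<close>, the coefficient at \<open>x\<close> then
        forces \<open>m\<close> out of \<open>q\<close>.\<close>
      let ?r = "mpoly_scale (Poly_Mapping.lookup p m) q - mpoly_scale (Poly_Mapping.lookup q m) p"
      have "?r = 0"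
      proof (rule sep)
        show "Poly_Mapping.keys ?r \<subseteq> T'"
        proof
          fix k assume k: "k \<in> Poly_Mapping.keys ?r"
          then have "k \<noteq> m" by (auto simp: in_keys_iff lookup_minus)
          moreover have "k \<in> Poly_Mapping.keys p \<or> k \<in> Poly_Mapping.keys q"
            using k by (auto simp: in_keys_iff lookup_minus)
          ultimately show "k \<in> T'" using p(2) q(1) by blast
        qed
        show "?L i ?r = 0" if "i < N" for i
        proof -
          interpret Vector_Spaces.linear mpoly_scale "(*)" "?L i" by (rule lin)
          show ?thesis using p(3)[OF that] q(2)[OF that] by (simp add: diff scale)
        qed
      qed
      then have "Poly_Mapping.lookup ?r x = 0" by (simp only: lookup_zero)
      moreover have "Poly_Mapping.lookup q x = 0"
        using q(1) m x xm(1) by (auto simp: in_keys_iff)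
      ultimately have "Poly_Mapping.lookup q m * Poly_Mapping.lookup p x = 0"
        by (simp add: lookup_minus)
      then have "m \<notin> Poly_Mapping.keys q"
        using x(1) by (simp add: in_keys_iff)
      then show "q = 0" using q sep[of q] by blast
    qed
    then show False using T' xm by (simp add: minimal_monomial_basis_def)
  qed

  show ?thesis
    using proper_T minimal unique by (auto simp: minimal_monomial_basis_def)
qed

end
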